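(* Let $\mathfrak g$ be one of the matrix Lie algebras $\mathfrak{gl}(n)$, $\mathfrak{sl}(n)$, $\mathfrak{so}(n)$, $\mathfrak u(n)$, $\mathfrak o(p,q)$, $\mathfrak{sp}(2n)$, let $l_0$ be a matrix in the corresponding ambient matrix space, and let $\mathrm{proj}_{\mathfrak g}(l_0)$ be given by the explicit formula for $\mathfrak g$ listed in the context. Then for every $v\in\mathfrak g$, $$\langle l_0-\mathrm{proj}_{\mathfrak g}(l_0),\,v\rangle=0.$$
   Context: $\langle A,B\rangle=\mathrm{Re}\,\mathrm{tr}(A^\dagger B)$ is the real Frobenius inner product. $\mathbb F$ denotes $\mathbb R$ or $\mathbb C$; $M_n(\mathbb F)$ is the space of $n\times n$ matrices over $\mathbb F$, $n\ge1$; $A^T$ is the transpose and $A^\dagger$ the conjugate transpose. $\eta$ is the diagonal matrix of size $p+q\ge 1$ with $p$ diagonal entries $+1$ and $q$ diagonal entries $-1$. $J=\begin{bmatrix}0&I_n\\-I_n&0\end{bmatrix}$, of size $2n$. The algebras, their ambient matrix spaces, and the maps $\mathrm{proj}_{\mathfrak g}$ are: (1) $\mathfrak{gl}(n)=M_n(\mathbb F)$, ambient $M_n(\mathbb F)$, $\mathrm{proj}(l_0)=l_0$. (2) $\mathfrak{sl}(n)=\{A\in M_n(\mathbb F):\mathrm{tr}\,A=0\}$, ambient $M_n(\mathbb F)$, $\mathrm{proj}(l_0)=l_0-\frac{\mathrm{tr}\,l_0}{n}I$. (3) $\mathfrak{so}(n)=\{A\in M_n(\mathbb R):A^T=-A\}$,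 ambient $M_n(\mathbb R)$, $\mathrm{proj}(l_0)=\frac12(l_0-l_0^T)$. (4) $\mathfrak u(n)=\{A\in M_n(\mathbb C):A^\dagger=-A\}$, ambient $M_n(\mathbb C)$, $\mathrm{proj}(l_0)=\frac12(l_0-l_0^\dagger)$. (5) $\mathfrak o(p,q)=\{A\in M_{p+q}(\mathbb R):A^T\eta+\eta A=0\}$, ambient $M_{p+q}(\mathbb R)$, $\mathrm{proj}(l_0)=\frac12(l_0-\eta l_0^T\eta)$. (6) $\mathfrak{sp}(2n)=\{A\in M_{2n}(\mathbb F):A^TJ+JA=0\}$, ambient $M_{2n}(\mathbb F)$, $\mathrm{proj}(l_0)=\frac12(l_0+J^Tl_0^TJ^T)$. *)

theory Defs
  imports Complex_Main "Jordan_Normal_Form.Schur_Decomposition"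
begin

(* A scalar type with conjugation and a real part, so that the Frobenius inner product has
   one definition for F = R (trivial conjugation, identity real part) and F = C. The class has
   no axioms on re_part; it is meant to be used at the types real and complex only. *)
class conj_re_field = conjugatable_field +
  fixes re_part :: "'a \<Rightarrow> real"

instantiation real :: conj_re_field
begin
definition re_part_real :: "real \<Rightarrow> real" where [simp]: "re_part_real x = x"
instance ..
end

instantiation complex :: conj_re_field
begin
definition re_part_complex :: "complex \<Rightarrow> real" where [simp]: "re_part_complex z = Re z"
instance ..
end

definition mat_trace :: "'a::comm_monoid_add mat \<Rightarrow> 'a" where
  "mat_trace A = (\<Sum>i<dim_row A. A $$ (i, i))"

definition frob :: "'a::conj_re_field mat \<Rightarrow> 'a mat \<Rightarrow> real" where
  "frob A B = re_part (mat_trace (mat_adjoint A * B))"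

definition eta_mat :: "nat \<Rightarrow> nat \<Rightarrow> real mat" where
  "eta_mat p q = four_block_mat (1\<^sub>m p) (0\<^sub>m p q) (0\<^sub>m q p) (- 1\<^sub>m q)"

definition J_mat :: "nat \<Rightarrow> 'a::field mat" where
  "J_mat n = four_block_mat (0\<^sub>m n n) (1\<^sub>m n) (- 1\<^sub>m n) (0\<^sub>m n n)"

definition gl_alg :: "nat \<Rightarrow> 'a::field mat set" where
  "gl_alg n = carrier_mat n n"

definition sl_alg :: "nat \<Rightarrow> 'a::field mat set" where
  "sl_alg n = {A \<in> carrier_mat n n. mat_trace A = 0}"

definition so_alg :: "nat \<Rightarrow> real mat set" where
  "so_alg n = {A \<in> carrier_mat n n. transpose_mat A = - A}"

definition u_alg :: "nat \<Rightarrow> complex mat set" where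
  "u_alg n = {A \<in> carrier_mat n n. mat_adjoint A = - A}"

definition o_alg :: "nat \<Rightarrow> nat \<Rightarrow> real mat set" where
  "o_alg p q = {A \<in> carrier_mat (p + q) (p + q).
     transpose_mat A * eta_mat p q + eta_mat p q * A = 0\<^sub>m (p + q) (p + q)}"

(* sp_alg n consists of matrices of size 2n. *)
definition sp_alg :: "nat \<Rightarrow> 'a::field mat set" where
  "sp_alg n = {A \<in> carrier_mat (2 * n) (2 * n).
     transpose_mat A * J_mat n + J_mat n * A = 0\<^sub>m (2 * n) (2 * n)}"

definition proj_gl :: "'a::field mat \<Rightarrow> 'a mat" where
  "proj_gl L = L"

definition proj_sl :: "nat \<Rightarrow> 'a::field mat \<Rightarrow> 'a mat" where
  "proj_sl n L = L - (mat_trace L / of_nat n) \<cdot>\<^sub>m 1\<^sub>m n"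

definition proj_so :: "real mat \<Rightarrow> real mat" where
  "proj_so L = (1 / 2) \<cdot>\<^sub>m (L - transpose_mat L)"

definition proj_u :: "complex mat \<Rightarrow> complex mat" where
  "proj_u L = (1 / 2) \<cdot>\<^sub>m (L - mat_adjoint L)"

definition proj_o :: "nat \<Rightarrow> nat \<Rightarrow> real mat \<Rightarrow> real mat" where
  "proj_o p q L = (1 / 2) \<cdot>\<^sub>m (L - eta_mat p q * transpose_mat L * eta_mat p q)"

definition proj_sp :: "nat \<Rightarrow> 'a::field mat \<Rightarrow> 'a mat" where
  "proj_sp n L = (1 / 2) \<cdot>\<^sub>m
     (L + transpose_mat (J_mat n) * transpose_mat L * transpose_mat (J_mat n))"

end

theory Submission
  imports Defs
begin

text \<open>
  Except for \<open>gl\<close> and \<open>sl\<close>, every algebra \<open>\<gg>\<close> in the list is the fixed space of a real-linear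
  map \<open>\<theta>\<close> that preserves the Frobenius inner product:
  \<open>\<theta> A = - A\<^sup>T\<close>, \<open>- A\<^sup>\<dagger>\<close>, \<open>- \<eta> A\<^sup>T \<eta>\<close> and \<open>J\<^sup>T A\<^sup>T J\<^sup>T\<close> respectively, and the projection
  is the average \<open>(L + \<theta> L) / 2\<close>. For \<open>v \<in> \<gg>\<close> one then has
  \<open>\<langle>\<theta> L, v\<rangle> = \<langle>\<theta> L, \<theta> v\<rangle> = \<langle>L, v\<rangle>\<close>, so \<open>v\<close> does not distinguish \<open>L\<close> from \<open>\<theta> L\<close> and is
  orthogonal to \<open>L - (L + \<theta> L) / 2 = (L - \<theta> L) / 2\<close>; this is lemma
  \<open>frob_average_residual\<close>. That \<open>\<theta>\<close> is an isometry follows from the invariance of the inner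
  product under negation, transposition, conjugate transposition and multiplication by
  unitary matrices, since \<open>\<eta>\<close> and \<open>J\<close> are real orthogonal. Multiplying the defining equation of
  \<open>\<gg>\<close> by \<open>\<eta>\<close> or by \<open>J\<close> shows that \<open>\<theta>\<close> fixes \<open>\<gg>\<close>.

  For \<open>gl\<close> the residual is zero. For \<open>sl\<close> it is a scalar matrix \<open>c I\<close>, and
  \<open>\<langle>c I, v\<rangle>\<close> is the real part of \<open>conj c \<cdot> tr v = 0\<close>.
\<close>

section \<open>The Frobenius inner product\<close>

text \<open>
  These two laws of the real part make the Frobenius form additive and symmetric
  under conjugation; together with characteristic zero, which permits halving, they allow
  the real and the complex cases to be treated at once.
\<close>

class re_field = conj_re_field + field_char_0 +
  assumes re_part_add: "re_part (x + y) = re_part x + re_part y"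
    and re_part_conjugate: "re_part (conjugate x) = re_part x"

instance real :: re_field
  by standard simp_all

instance complex :: re_field
  by standard simp_all

lemma re_part_zero: "re_part (0 :: 'a::re_field) = 0"
  using re_part_add[of "0 :: 'a" 0] by simp

lemma re_part_uminus: "re_part (- x) = - re_part (x :: 'a::re_field)"
  using re_part_add[of x "- x"] by (simp add: re_part_zero)

lemma re_part_diff: "re_part (x - y) = re_part x - re_part (y :: 'a::re_field)"
  using re_part_add[of x "- y"] by (simp add: re_part_uminus)

lemma conjugate_one: "conjugate (1 :: 'a::conjugatable_field) = 1"
proof -
  have "conjugate (1 :: 'a) * conjugate 1 = conjugate 1"
    by (metis conjugate_dist_mul mult_1)
  then show ?thesis
    by simp
qed

lemma dim_mat_adjoint [simp]:
  "dim_row (mat_adjoint A) = dim_col A" "dim_col (mat_adjoint A) = dim_row A"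
  by (simp_all add: mat_adjoint_def)

lemma index_mat_adjoint [simp]:
  "i < dim_col A \<Longrightarrow> j < dim_row A \<Longrightarrow> mat_adjoint A $$ (i, j) = conjugate (A $$ (j, i))"
  by (simp add: mat_adjoint_def mat_of_rows_index)

lemma mat_adjoint_carrier [simp]: "A \<in> carrier_mat m n \<Longrightarrow> mat_adjoint A \<in> carrier_mat n m"
  by auto

lemma mat_adjoint_mat_adjoint [simp]: "mat_adjoint (mat_adjoint A) = A"
  by (rule eq_matI) auto

lemma mat_adjoint_mult:
  fixes A B :: "'a::conjugatable_field mat"
  assumes "A \<in> carrier_mat m k" "B \<in> carrier_mat k n"
  shows "mat_adjoint (A * B) = mat_adjoint B * mat_adjoint A"
  using assms
  by (intro eq_matI)
    (auto simp: scalar_prod_def sum_conjugate conjugate_dist_mul mult.commute intro!: sum.cong)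

lemma frob_eq_sum:
  assumes "A \<in> carrier_mat m n" "B \<in> carrier_mat m n"
  shows "frob A B = re_part (\<Sum>i<m. \<Sum>j<n. conjugate (A $$ (i, j)) * B $$ (i, j))"
proof -
  have "mat_trace (mat_adjoint A * B) = (\<Sum>j<n. \<Sum>i<m. conjugate (A $$ (i, j)) * B $$ (i, j))"
    using assms
    by (auto simp: mat_trace_def scalar_prod_def atLeast0LessThan intro!: sum.cong)
  then show ?thesis
    unfolding frob_def by (subst sum.swap) simp
qed

lemma frob_diff_left:
  fixes A B C :: "'a::re_field mat"
  assumes "A \<in> carrier_mat m n" "B \<in> carrier_mat m n" "C \<in> carrier_mat m n"
  shows "frob (A - B) C = frob A C - frob B C"
proof -
  have conj: "conjugate (x - y) = conjugate x - conjugate y" for x y :: 'a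
    using conjugate_dist_add[of x "- y"] by (simp add: conjugate_neg)
  have "A - B \<in> carrier_mat m n"
    using assms by auto
  then show ?thesis
    using assms
    by (simp add: frob_eq_sum[of _ m n] conj left_diff_distrib sum_subtractf re_part_diff)
qed

lemma frob_uminus_uminus:
  fixes A B :: "'a::re_field mat"
  assumes "A \<in> carrier_mat m n" "B \<in> carrier_mat m n"
  shows "frob (- A) (- B) = frob A B"
  using assms by (simp add: frob_eq_sum[of _ m n] conjugate_neg)

lemma frob_transpose:
  fixes A B :: "'a::re_field mat"
  assumes "A \<in> carrier_mat m n" "B \<in> carrier_mat m n"
  shows "frob (transpose_mat A) (transpose_mat B) = frob A B"
proof -
  have "frob (transpose_mat A) (transpose_mat B)
      = re_part (\<Sum>i<n. \<Sum>j<m. conjugate (A $$ (j, i)) * B $$ (j, i))"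
    using assms by (simp add: frob_eq_sum[of _ n m])
  also have "\<dots> = frob A B"
    using assms by (subst sum.swap) (simp add: frob_eq_sum[of _ m n])
  finally show ?thesis .
qed

text \<open>
  Over the complex numbers conjugate transposition replaces the Hermitian product by its
  conjugate; only the real part is invariant.
\<close>

lemma frob_adjoint:
  fixes A B :: "'a::re_field mat"
  assumes "A \<in> carrier_mat m n" "B \<in> carrier_mat m n"
  shows "frob (mat_adjoint A) (mat_adjoint B) = frob A B"
proof -
  have "frob (mat_adjoint A) (mat_adjoint B)
      = re_part (\<Sum>i<n. \<Sum>j<m. conjugate (conjugate (A $$ (j, i)) * B $$ (j, i)))"
    using assms by (simp add: frob_eq_sum[of _ n m] conjugate_dist_mul)
  also have "\<dots> = re_part (conjugate (\<Sum>i<n. \<Sum>j<m. conjugate (A $$ (j, i)) * B $$ (j, i)))"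
    by (simp add: sum_conjugate)
  also have "\<dots> = frob A B"
    unfolding re_part_conjugate
    using assms by (subst sum.swap) (simp add: frob_eq_sum[of _ m n])
  finally show ?thesis .
qed

lemma frob_unitary_left:
  fixes U A B :: "'a::re_field mat"
  assumes U: "U \<in> carrier_mat m m" "mat_adjoint U * U = 1\<^sub>m m"
    and A: "A \<in> carrier_mat m n" and B: "B \<in> carrier_mat m n"
  shows "frob (U * A) (U * B) = frob A B"
proof -
  have "mat_adjoint (U * A) * (U * B) = mat_adjoint A * (mat_adjoint U * (U * B))"
    unfolding mat_adjoint_mult[OF U(1) A]
    using U(1) A B by (intro assoc_mult_mat[of _ n m _ m _ n]) auto
  also have "mat_adjoint U * (U * B) = mat_adjoint U * U * B"
    using U(1) B by (intro assoc_mult_mat[symmetric, of _ m m _ m _ n]) auto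
  also have "\<dots> = B"
    using U(2) B by simp
  finally show ?thesis
    by (simp add: frob_def)
qed

text \<open>Passing to adjoints turns right multiplication into left multiplication.\<close>

lemma frob_unitary_right:
  fixes V A B :: "'a::re_field mat"
  assumes V: "V \<in> carrier_mat n n" "V * mat_adjoint V = 1\<^sub>m n"
    and A: "A \<in> carrier_mat m n" and B: "B \<in> carrier_mat m n"
  shows "frob (A * V) (B * V) = frob A B"
proof -
  have "frob (A * V) (B * V) = frob (mat_adjoint (A * V)) (mat_adjoint (B * V))"
    using V(1) A B by (intro frob_adjoint[symmetric, of _ m n]) auto
  also have "\<dots> = frob (mat_adjoint V * mat_adjoint A) (mat_adjoint V * mat_adjoint B)"
    by (simp only: mat_adjoint_mult[OF A V(1)] mat_adjoint_mult[OF B V(1)])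
  also have "\<dots> = frob (mat_adjoint A) (mat_adjoint B)"
    using V A B by (intro frob_unitary_left[of _ n _ m]) auto
  also have "\<dots> = frob A B"
    using A B by (rule frob_adjoint)
  finally show ?thesis .
qed

lemma frob_unitary_transpose:
  fixes U V A B :: "'a::re_field mat"
  assumes U: "U \<in> carrier_mat n n" "mat_adjoint U * U = 1\<^sub>m n"
    and V: "V \<in> carrier_mat n n" "V * mat_adjoint V = 1\<^sub>m n"
    and A: "A \<in> carrier_mat n n" and B: "B \<in> carrier_mat n n"
  shows "frob (U * transpose_mat A * V) (U * transpose_mat B * V) = frob A B"
proof -
  have "frob (U * transpose_mat A * V) (U * transpose_mat B * V)
      = frob (U * transpose_mat A) (U * transpose_mat B)"
    using U V A B by (intro frob_unitary_right[of _ n _ n]) auto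
  also have "\<dots> = frob (transpose_mat A) (transpose_mat B)"
    using U A B by (intro frob_unitary_left[of _ n _ n]) auto
  also have "\<dots> = frob A B"
    using A B by (rule frob_transpose)
  finally show ?thesis .
qed

section \<open>Residuals of the projections\<close>

text \<open>
  The midpoint \<open>P\<close> of \<open>L\<close> and \<open>M\<close> satisfies \<open>L - P = P - M\<close>, so the product of the residual
  with \<open>v\<close> is half of \<open>\<langle>L, v\<rangle> - \<langle>M, v\<rangle>\<close>. The use is with \<open>M = \<theta> L\<close>.
\<close>

lemma frob_average_residual:
  fixes L M v :: "'a::re_field mat"
  assumes L: "L \<in> carrier_mat m n" and M: "M \<in> carrier_mat m n" and v: "v \<in> carrier_mat m n"
    and eq: "frob M v = frob L v"
  shows "frob (L - (1 / 2) \<cdot>\<^sub>m (L + M)) v = 0"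
proof -
  define P where "P = (1 / 2) \<cdot>\<^sub>m (L + M)"
  have P: "P \<in> carrier_mat m n"
    using L M by (auto simp: P_def)
  have "L - P = P - M"
    using L M by (intro eq_matI) (auto simp: P_def field_simps)
  then have "frob L v - frob P v = frob P v - frob M v"
    using frob_diff_left[OF L P v] frob_diff_left[OF P M v] by simp
  then show ?thesis
    using frob_diff_left[OF L P v] eq by (simp add: P_def)
qed

lemma frob_proj_gl_residual:
  fixes L v :: "'a::re_field mat"
  assumes "L \<in> carrier_mat n n" "v \<in> gl_alg n"
  shows "frob (L - proj_gl L) v = 0"
  using assms frob_diff_left[of L n n L v] by (simp add: gl_alg_def proj_gl_def)

lemma frob_proj_sl_residual:
  fixes L v :: "'a::re_field mat"
  assumes L: "L \<in> carrier_mat n n" and v: "v \<in> sl_alg n"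
  shows "frob (L - proj_sl n L) v = 0"
proof -
  define c where "c = mat_trace L / of_nat n"
  have v: "v \<in> carrier_mat n n" "mat_trace v = 0"
    using v by (auto simp: sl_alg_def)
  have res: "L - proj_sl n L = c \<cdot>\<^sub>m 1\<^sub>m n"
    using L by (intro eq_matI) (auto simp: proj_sl_def c_def)
  have "frob (c \<cdot>\<^sub>m 1\<^sub>m n) v
      = re_part (\<Sum>i<n. \<Sum>j<n. conjugate ((c \<cdot>\<^sub>m 1\<^sub>m n) $$ (i, j)) * v $$ (i, j))"
    using v(1) by (intro frob_eq_sum) auto
  also have "(\<Sum>i<n. \<Sum>j<n. conjugate ((c \<cdot>\<^sub>m 1\<^sub>m n) $$ (i, j)) * v $$ (i, j))
      = (\<Sum>i<n. \<Sum>j<n. if i = j then conjugate c * v $$ (i, j) else 0)"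
    by (intro sum.cong) auto
  also have "\<dots> = conjugate c * mat_trace v"
    using v(1) by (simp add: mat_trace_def sum_distrib_left)
  finally show ?thesis
    using v(2) by (simp add: res re_part_zero)
qed

lemma frob_proj_so_residual:
  assumes L: "L \<in> carrier_mat n n" and v: "v \<in> so_alg n"
  shows "frob (L - proj_so L) v = 0"
proof -
  have v: "v \<in> carrier_mat n n" "- transpose_mat v = v"
    using v by (auto simp: so_alg_def)
  have "frob (- transpose_mat L) v = frob (- transpose_mat L) (- transpose_mat v)"
    by (simp only: v(2))
  also have "\<dots> = frob L v"
    using L v(1) by (simp add: frob_uminus_uminus[of _ n n] frob_transpose[of _ n n])
  finally have eq: "frob (- transpose_mat L) v = frob L v" .
  have "proj_so L = (1 / 2) \<cdot>\<^sub>m (L + - transpose_mat L)"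
    using L by (auto simp: proj_so_def)
  then show ?thesis
    using L v(1) eq frob_average_residual[of L n n "- transpose_mat L" v] by simp
qed

lemma frob_proj_u_residual:
  assumes L: "L \<in> carrier_mat n n" and v: "v \<in> u_alg n"
  shows "frob (L - proj_u L) v = 0"
proof -
  have v: "v \<in> carrier_mat n n" "- mat_adjoint v = v"
    using v by (auto simp: u_alg_def)
  have "frob (- mat_adjoint L) v = frob (- mat_adjoint L) (- mat_adjoint v)"
    by (simp only: v(2))
  also have "\<dots> = frob L v"
    using L v(1) by (simp add: frob_uminus_uminus[of _ n n] frob_adjoint[of _ n n])
  finally have eq: "frob (- mat_adjoint L) v = frob L v" .
  have "proj_u L = (1 / 2) \<cdot>\<^sub>m (L + - mat_adjoint L)"
    using L by (auto simp: proj_u_def)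
  then show ?thesis
    using L v(1) eq frob_average_residual[of L n n "- mat_adjoint L" v] by simp
qed

lemma add_mat_eq_zeroD:
  fixes A B :: "'a::group_add mat"
  assumes A: "A \<in> carrier_mat m n" and B: "B \<in> carrier_mat m n" and "A + B = 0\<^sub>m m n"
  shows "- A = B"
proof (rule eq_matI)
  fix i j assume "i < dim_row B" "j < dim_col B"
  then have ij: "i < m" "j < n"
    using B by auto
  then have "(A + B) $$ (i, j) = 0"
    by (simp add: assms(3))
  then show "(- A) $$ (i, j) = B $$ (i, j)"
    using A B ij by (simp add: minus_unique)
qed (use A B in auto)

lemma eta_mat_carrier [simp]: "eta_mat p q \<in> carrier_mat (p + q) (p + q)"
  by (simp add: eta_mat_def)

lemma mat_adjoint_eta: "mat_adjoint (eta_mat p q) = eta_mat p q"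
  by (rule eq_matI) (auto simp: eta_mat_def)

lemma eta_mult_eta: "eta_mat p q * eta_mat p q = 1\<^sub>m (p + q)"
proof -
  have "eta_mat p q * eta_mat p q
      = four_block_mat (1\<^sub>m p) (- 0\<^sub>m p q) (0\<^sub>m q p) (1\<^sub>m q)"
    unfolding eta_mat_def
    by (subst mult_four_block_mat[of _ p p _ q _ q _ _ p _ q]) auto
  also have "\<dots> = 1\<^sub>m (p + q)"
    by (rule eq_matI) auto
  finally show ?thesis .
qed

lemma o_alg_fixed:
  assumes "v \<in> o_alg p q"
  shows "- (eta_mat p q * transpose_mat v * eta_mat p q) = v"
proof -
  let ?\<eta> = "eta_mat p q" and ?m = "p + q"
  have v: "v \<in> carrier_mat ?m ?m"
    and sum0: "transpose_mat v * ?\<eta> + ?\<eta> * v = 0\<^sub>m ?m ?m"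
    using assms by (auto simp: o_alg_def)
  have "?\<eta> * (?\<eta> * v) = ?\<eta> * ?\<eta> * v"
    using v by (intro assoc_mult_mat[symmetric, of _ ?m ?m _ ?m _ ?m]) auto
  then have "?\<eta> * (?\<eta> * v) = v"
    using v by (simp add: eta_mult_eta)
  moreover have "?\<eta> * transpose_mat v * ?\<eta> = ?\<eta> * (transpose_mat v * ?\<eta>)"
    using v by (intro assoc_mult_mat[of _ ?m ?m _ ?m _ ?m]) auto
  ultimately have "?\<eta> * transpose_mat v * ?\<eta> + v
      = ?\<eta> * (transpose_mat v * ?\<eta>) + ?\<eta> * (?\<eta> * v)"
    by simp
  also have "\<dots> = ?\<eta> * (transpose_mat v * ?\<eta> + ?\<eta> * v)"
    using v
    by (intro mult_add_distrib_mat[symmetric, of _ ?m ?m _ ?m])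
      (auto intro: mult_carrier_mat[of _ ?m ?m])
  also have "\<dots> = 0\<^sub>m ?m ?m"
    unfolding sum0 by (rule right_mult_zero_mat) simp
  finally have zero: "?\<eta> * transpose_mat v * ?\<eta> + v = 0\<^sub>m ?m ?m" .
  have "?\<eta> * transpose_mat v * ?\<eta> \<in> carrier_mat ?m ?m"
    using v by (intro mult_carrier_mat[of _ ?m ?m]) auto
  from add_mat_eq_zeroD[OF this v zero] show ?thesis .
qed

lemma frob_proj_o_residual:
  assumes L: "L \<in> carrier_mat (p + q) (p + q)" and v: "v \<in> o_alg p q"
  shows "frob (L - proj_o p q L) v = 0"
proof -
  let ?\<eta> = "eta_mat p q" and ?m = "p + q"
  let ?\<theta> = "\<lambda>A. - (?\<eta> * transpose_mat A * ?\<eta>)"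
  have fixed: "?\<theta> v = v"
    using v by (rule o_alg_fixed)
  have v: "v \<in> carrier_mat ?m ?m"
    using v by (simp add: o_alg_def)
  have carrier: "?\<eta> * transpose_mat A * ?\<eta> \<in> carrier_mat ?m ?m" if "A \<in> carrier_mat ?m ?m" for A
    using that by (intro mult_carrier_mat[of _ ?m ?m]) auto
  have "frob (?\<theta> L) v = frob (?\<theta> L) (?\<theta> v)"
    by (simp only: fixed)
  also have "\<dots> = frob (?\<eta> * transpose_mat L * ?\<eta>) (?\<eta> * transpose_mat v * ?\<eta>)"
    using carrier[OF L] carrier[OF v] by (rule frob_uminus_uminus)
  also have "\<dots> = frob L v"
    using L v by (intro frob_unitary_transpose[of _ ?m]) (auto simp: mat_adjoint_eta eta_mult_eta)
  finally have eq: "frob (?\<theta> L) v = frob L v" .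
  have "proj_o p q L = (1 / 2) \<cdot>\<^sub>m (L + ?\<theta> L)"
    using carrier[OF L] L by (simp only: proj_o_def add_uminus_minus_mat[OF L carrier[OF L]])
  then show ?thesis
    using frob_average_residual[OF L _ v eq] carrier[OF L] by simp
qed

lemma J_mat_carrier [simp]: "J_mat n \<in> carrier_mat (2 * n) (2 * n)"
  by (simp add: J_mat_def mult_2)

lemma dim_J_mat [simp]: "dim_row (J_mat n) = 2 * n" "dim_col (J_mat n) = 2 * n"
  by (rule carrier_matD[OF J_mat_carrier])+

lemma transpose_J: "transpose_mat (J_mat n) = - J_mat n"
  by (rule eq_matI) (auto simp: J_mat_def)

lemma mat_adjoint_J:
  "mat_adjoint (J_mat n :: 'a::conjugatable_field mat) = transpose_mat (J_mat n)"
  by (rule eq_matI) (auto simp: J_mat_def conjugate_neg conjugate_one)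

lemma J_mult_J: "J_mat n * J_mat n = - 1\<^sub>m (2 * n)"
proof -
  have "J_mat n * J_mat n
      = four_block_mat (- 1\<^sub>m n) (0\<^sub>m n n) (0\<^sub>m n n) (- 1\<^sub>m n :: 'a mat)"
    unfolding J_mat_def
    by (subst mult_four_block_mat[of _ n n _ n _ n _ _ n _ n]) auto
  also have "\<dots> = - 1\<^sub>m (2 * n)"
    by (rule eq_matI) auto
  finally show ?thesis .
qed

lemma mat_adjoint_transpose_J:
  "mat_adjoint (transpose_mat (J_mat n)) = (J_mat n :: 'a::conjugatable_field mat)"
  by (simp flip: mat_adjoint_J)

text \<open>
  With \<open>J\<^sup>T = - J\<close> and \<open>J\<^sup>2 = - I\<close>, the map \<open>\<theta> v = J\<^sup>T v\<^sup>T J\<^sup>T\<close> is \<open>J v\<^sup>T J\<close>, and left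
  multiplication of \<open>v\<^sup>T J + J v = 0\<close> by \<open>J\<close> gives \<open>J v\<^sup>T J - v = 0\<close>.
\<close>

lemma sp_alg_fixed:
  assumes "v \<in> sp_alg n"
  shows "transpose_mat (J_mat n) * transpose_mat v * transpose_mat (J_mat n) = v"
proof -
  let ?J = "J_mat n :: 'a mat" and ?m = "2 * n"
  have v: "v \<in> carrier_mat ?m ?m"
    and sum0: "transpose_mat v * ?J + ?J * v = 0\<^sub>m ?m ?m"
    using assms by (auto simp: sp_alg_def)
  have vJ: "transpose_mat v * ?J \<in> carrier_mat ?m ?m" and Jv: "?J * v \<in> carrier_mat ?m ?m"
    using v by (auto intro: mult_carrier_mat[of _ ?m ?m])
  have JvJ: "?J * (transpose_mat v * ?J) \<in> carrier_mat ?m ?m"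
    by (rule mult_carrier_mat[OF J_mat_carrier vJ])
  have "?J * (?J * v) = ?J * ?J * v"
    using v by (intro assoc_mult_mat[symmetric, of _ ?m ?m _ ?m _ ?m]) auto
  also have "\<dots> = - v"
    using v by (simp add: J_mult_J)
  finally have JJv: "?J * (?J * v) = - v" .
  have "?J * (transpose_mat v * ?J) + - v = ?J * (transpose_mat v * ?J + ?J * v)"
    using vJ Jv by (simp add: mult_add_distrib_mat[of _ ?m ?m _ ?m] JJv)
  also have "\<dots> = 0\<^sub>m ?m ?m"
    unfolding sum0 by (rule right_mult_zero_mat) simp
  finally have zero: "?J * (transpose_mat v * ?J) + - v = 0\<^sub>m ?m ?m" .
  have "- v \<in> carrier_mat ?m ?m"
    using v by simp
  from add_mat_eq_zeroD[OF JvJ this zero] have "?J * (transpose_mat v * ?J) = v"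
    by simp
  moreover have "transpose_mat ?J * transpose_mat v * transpose_mat ?J
      = ?J * (transpose_mat v * ?J)"
    using v by (simp add: transpose_J assoc_mult_mat[of _ ?m ?m _ ?m _ ?m])
  ultimately show ?thesis
    by simp
qed

lemma frob_proj_sp_residual:
  fixes L v :: "'a::re_field mat"
  assumes L: "L \<in> carrier_mat (2 * n) (2 * n)" and v: "v \<in> sp_alg n"
  shows "frob (L - proj_sp n L) v = 0"
proof -
  let ?K = "transpose_mat (J_mat n) :: 'a mat" and ?m = "2 * n"
  let ?\<theta> = "\<lambda>A. ?K * transpose_mat A * ?K"
  have fixed: "?\<theta> v = v"
    using v by (rule sp_alg_fixed)
  have v: "v \<in> carrier_mat ?m ?m"
    using v by (simp add: sp_alg_def)
  have carrier: "?\<theta> L \<in> carrier_mat ?m ?m"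
    using L by (intro mult_carrier_mat[of _ ?m ?m]) auto
  have unitary: "mat_adjoint ?K * ?K = 1\<^sub>m ?m" "?K * mat_adjoint ?K = 1\<^sub>m ?m"
    by (simp_all only: mat_adjoint_transpose_J) (simp_all add: transpose_J J_mult_J)
  have "frob (?\<theta> L) v = frob (?\<theta> L) (?\<theta> v)"
    by (simp only: fixed)
  also have "\<dots> = frob L v"
    using L v unitary by (intro frob_unitary_transpose[of _ ?m]) auto
  finally show ?thesis
    unfolding proj_sp_def by (rule frob_average_residual[OF L carrier v])
qed

theorem theorem2:
  fixes n p q :: nat
  assumes "n \<ge> 1" and "p + q \<ge> 1"
  shows
    "(\<forall>L \<in> carrier_mat n n. \<forall>v \<in> gl_alg n. frob (L - proj_gl L) (v :: real mat) = 0) \<and>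
     (\<forall>L \<in> carrier_mat n n. \<forall>v \<in> gl_alg n. frob (L - proj_gl L) (v :: complex mat) = 0) \<and>
     (\<forall>L \<in> carrier_mat n n. \<forall>v \<in> sl_alg n. frob (L - proj_sl n L) (v :: real mat) = 0) \<and>
     (\<forall>L \<in> carrier_mat n n. \<forall>v \<in> sl_alg n. frob (L - proj_sl n L) (v :: complex mat) = 0) \<and>
     (\<forall>L \<in> carrier_mat n n. \<forall>v \<in> so_alg n. frob (L - proj_so L) v = 0) \<and>
     (\<forall>L \<in> carrier_mat n n. \<forall>v \<in> u_alg n. frob (L - proj_u L) v = 0) \<and>
     (\<forall>L \<in> carrier_mat (p + q) (p + q). \<forall>v \<in> o_alg p q. frob (L - proj_o p q L) v = 0) \<and>
     (\<forall>L \<in> carrier_mat (2 * n) (2 * n). \<forall>v \<in> sp_alg n.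
        frob (L - proj_sp n L) (v :: real mat) = 0) \<and>
     (\<forall>L \<in> carrier_mat (2 * n) (2 * n). \<forall>v \<in> sp_alg n.
        frob (L - proj_sp n L) (v :: complex mat) = 0)"
  by (intro conjI ballI frob_proj_gl_residual frob_proj_sl_residual frob_proj_so_residual
      frob_proj_u_residual frob_proj_o_residual frob_proj_sp_residual)

end
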